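(* Let $G$ be a Lie group and let $d:G\times G\to\mathbb R$ be a metric on $G$ such that $\tau_d=\tau_G$. Let $X=\{x_1,\ldots,x_k\}\ni e$ be a finite subset of $G$ such that $H_X=\{e\}$, and let $d,d^1,d^2,\ldots$ be the sequence of induced Hausdorff metrics on $G$ associated with $X$ (for the action of $G$ on itself by left multiplication). Then $d\le d^1$ and the sequence of induced Hausdorff metrics is increasing, i.e. $d\le d^1\le d^2\le\cdots$ on $G\times G$.
   Context: Notation. "Metric" means distance function; an extended metric may take the value $\infty$. $\tau_\rho$ is the topology induced by $\rho$ and $\tau_G$ is the manifold topology of $G$; $e$ is the identity. Lengths and intrinsic metrics. For a path $\gamma:[a,b]\to M$ in an (extended) metric space $(M,\rho)$, $\ell_\rho(\gamma)=\sup\sum_i\rho(\gamma(t_i),\gamma(t_{i-1}))$ over all partitions of $[a,b]$. The intrinsic (extended) metric induced by $\rho$ is $\hat\rho(x,y)=\inf_\gamma\ell_\rho(\gamma)$ over all continuous paths in $(M,\rho)$ connecting $x$ and $y$ ($\inf\emptyset=\infty$). Sequence of induced Hausdorff metrics. For a finite $X\subset G$ put $gX=\{gx:x\in X\}$ and $H_X=\{g\in G: gX=X\}$. For an (extended) metric $\rho$ on $G$, let $\rho_H(A,B)=\max\{\max_{a\in A}\min_{b\in B}\rho(a,b),\max_{b\in B}\min_{a\in A}\rho(a,b)\}$ for finite nonempty $A,B$. If $H_X=\{e\}$, then $\rho_X(g,h):=\rho_H(gX,hX)$ is an (extended) metric on $G$. The sequence of induced Hausdorff metrics is $d^0=d$,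 $d^{i}=\widehat{(d^{i-1})_X}$ for $i\ge1$; its terms $d^i$, $i\geq 1$, may be extended metrics. *)

theory Defs
  imports "HOL-Analysis.Analysis" "HOL-Algebra.Coset"
begin

section \<open>Smooth manifolds and Lie groups\<close>

text \<open>The model space is \<^const>\<open>Euclidean_space\<close> \<open>n\<close>, whose points are the functions
  \<open>nat \<Rightarrow> real\<close> vanishing from index \<open>n\<close> on. The dimension \<open>n = 0\<close> is allowed, so
  that countable discrete groups are Lie groups.\<close>

definition partial_deriv :: "nat \<Rightarrow> ((nat \<Rightarrow> real) \<Rightarrow> real) \<Rightarrow> (nat \<Rightarrow> real) \<Rightarrow> real" where
  "partial_deriv i f x = deriv (\<lambda>t. f (x(i := t))) (x i)"

text \<open>Class \<open>C\<^sup>k\<close> on \<open>U\<close>; meaningful for \<open>U\<close> open in \<^const>\<open>Euclidean_space\<close> \<open>n\<close>.\<close>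

fun Ck_on :: "nat \<Rightarrow> nat \<Rightarrow> (nat \<Rightarrow> real) set \<Rightarrow> ((nat \<Rightarrow> real) \<Rightarrow> real) \<Rightarrow> bool" where
  "Ck_on 0 n U f \<longleftrightarrow> continuous_map (subtopology (Euclidean_space n) U) euclideanreal f"
| "Ck_on (Suc k) n U f \<longleftrightarrow>
     continuous_map (subtopology (Euclidean_space n) U) euclideanreal f \<and>
     (\<forall>i<n. (\<forall>x\<in>U. (\<lambda>t. f (x(i := t))) field_differentiable at (x i)) \<and>
            Ck_on k n U (partial_deriv i f))"

definition smooth_into :: "nat \<Rightarrow> nat \<Rightarrow> (nat \<Rightarrow> real) set \<Rightarrow> ((nat \<Rightarrow> real) \<Rightarrow> nat \<Rightarrow> real) \<Rightarrow> bool" where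
  "smooth_into n m U f \<longleftrightarrow> (\<forall>j<m. \<forall>k. Ck_on k n U (\<lambda>x. f x j))"

text \<open>A chart is a pair \<open>(U, \<phi>)\<close> of its domain and its coordinate map; the inverse of \<open>\<phi>\<close> is
  \<open>inv_into U \<phi>\<close>.\<close>

type_synonym 'a chart = "'a set \<times> ('a \<Rightarrow> nat \<Rightarrow> real)"

definition is_chart :: "nat \<Rightarrow> 'a topology \<Rightarrow> 'a chart \<Rightarrow> bool" where
  "is_chart n T = (\<lambda>(U, \<phi>).
     openin T U \<and> openin (Euclidean_space n) (\<phi> ` U) \<and>
     homeomorphic_map (subtopology T U) (subtopology (Euclidean_space n) (\<phi> ` U)) \<phi>)"

definition smooth_atlas :: "nat \<Rightarrow> 'a topology \<Rightarrow> 'a chart set \<Rightarrow> bool" where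
  "smooth_atlas n T A \<longleftrightarrow>
     (\<forall>c\<in>A. is_chart n T c) \<and> (\<Union>(U, \<phi>)\<in>A. U) = topspace T \<and>
     (\<forall>(U, \<phi>)\<in>A. \<forall>(V, \<psi>)\<in>A. smooth_into n n (\<phi> ` (U \<inter> V)) (\<psi> \<circ> inv_into U \<phi>))"

definition smooth_manifold :: "nat \<Rightarrow> 'a topology \<Rightarrow> 'a chart set \<Rightarrow> bool" where
  "smooth_manifold n T A \<longleftrightarrow>
     Hausdorff_space T \<and> second_countable T \<and> smooth_atlas n T A"

definition smooth_map ::
  "nat \<Rightarrow> 'a topology \<Rightarrow> 'a chart set \<Rightarrow> nat \<Rightarrow> 'b topology \<Rightarrow> 'b chart set \<Rightarrow> ('a \<Rightarrow> 'b) \<Rightarrow> bool" where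
  "smooth_map n T A m T' B f \<longleftrightarrow>
     continuous_map T T' f \<and>
     (\<forall>(U, \<phi>)\<in>A. \<forall>(V, \<psi>)\<in>B.
        smooth_into n m (\<phi> ` (U \<inter> f -` V)) (\<psi> \<circ> f \<circ> inv_into U \<phi>))"

definition append_coords :: "nat \<Rightarrow> (nat \<Rightarrow> real) \<Rightarrow> (nat \<Rightarrow> real) \<Rightarrow> nat \<Rightarrow> real" where
  "append_coords n x y = (\<lambda>i. if i < n then x i else y (i - n))"

definition prod_atlas :: "nat \<Rightarrow> 'a chart set \<Rightarrow> 'b chart set \<Rightarrow> ('a \<times> 'b) chart set" where
  "prod_atlas n A B =
     {(U \<times> V, \<lambda>(x, y). append_coords n (\<phi> x) (\<psi> y)) | U \<phi> V \<psi>. (U, \<phi>) \<in> A \<and> (V, \<psi>) \<in> B}"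

definition lie_group :: "('a, 'b) monoid_scheme \<Rightarrow> nat \<Rightarrow> 'a topology \<Rightarrow> 'a chart set \<Rightarrow> bool" where
  "lie_group G n T A \<longleftrightarrow>
     group G \<and> topspace T = carrier G \<and> smooth_manifold n T A \<and>
     smooth_map (n + n) (prod_topology T T) (prod_atlas n A A) n T A (\<lambda>(x, y). x \<otimes>\<^bsub>G\<^esub> y) \<and>
     smooth_map n T A n T A (\<lambda>x. inv\<^bsub>G\<^esub> x)"


section \<open>Extended metrics, lengths and intrinsic metrics\<close>

text \<open>The topology induced by an extended metric \<open>\<rho>\<close> on the set \<open>M\<close>.\<close>

definition emtopology :: "'a set \<Rightarrow> ('a \<Rightarrow> 'a \<Rightarrow> ennreal) \<Rightarrow> 'a topology" where
  "emtopology M \<rho> =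
     topology (\<lambda>U. U \<subseteq> M \<and> (\<forall>x\<in>U. \<exists>r>0. \<forall>y\<in>M. \<rho> x y < r \<longrightarrow> y \<in> U))"

lemma openin_emtopology:
  "openin (emtopology M \<rho>) U \<longleftrightarrow> U \<subseteq> M \<and> (\<forall>x\<in>U. \<exists>r>0. \<forall>y\<in>M. \<rho> x y < r \<longrightarrow> y \<in> U)"
proof -
  let ?P = "\<lambda>U. U \<subseteq> M \<and> (\<forall>x\<in>U. \<exists>r>0. \<forall>y\<in>M. \<rho> x y < r \<longrightarrow> y \<in> U)"
  have "?P (S \<inter> S')" if S: "?P S" and S': "?P S'" for S S'
  proof (intro conjI ballI)
    fix x assume "x \<in> S \<inter> S'"
    then obtain r r' where "r > 0" "\<forall>y\<in>M. \<rho> x y < r \<longrightarrow> y \<in> S"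
      "r' > 0" "\<forall>y\<in>M. \<rho> x y < r' \<longrightarrow> y \<in> S'"
      using S S' by blast
    then show "\<exists>r>0. \<forall>y\<in>M. \<rho> x y < r \<longrightarrow> y \<in> S \<inter> S'"
      by (intro exI[of _ "min r r'"]) auto
  qed (use S in blast)
  moreover have "?P (\<Union>\<K>)" if "\<forall>K\<in>\<K>. ?P K" for \<K>
    using that by (auto simp: subset_iff; meson UnionI)
  ultimately have "istopology ?P"
    unfolding istopology_def by blast
  then show ?thesis
    by (simp add: emtopology_def)
qed

lemma emtopology_ennreal:
  assumes "Metric_space M d"
  shows "emtopology M (\<lambda>x y. ennreal (d x y)) = Metric_space.mtopology M d"
proof -
  interpret Metric_space M d by fact
  have "(\<exists>r>0. \<forall>y\<in>M. ennreal (d x y) < r \<longrightarrow> y \<in> U) \<longleftrightarrow> (\<exists>r>0. mball x r \<subseteq> U)"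
    if "x \<in> M" for x U
  proof
    assume "\<exists>r>0. \<forall>y\<in>M. ennreal (d x y) < r \<longrightarrow> y \<in> U"
    then obtain r where "r > 0" and r: "\<forall>y\<in>M. ennreal (d x y) < r \<longrightarrow> y \<in> U" by blast
    then obtain q :: real where q: "q > 0" "ennreal q < r"
      by (metis dense ennreal_cases ennreal_eq_0_iff leD leI not_less_iff_gr_or_eq top_greatest)
    have "mball x q \<subseteq> U"
    proof
      fix y assume "y \<in> mball x q"
      then have "y \<in> M" "ennreal (d x y) < ennreal q"
        by (auto intro: ennreal_lessI q)
      then show "y \<in> U" using r q(2) by (meson less_trans)
    qed
    then show "\<exists>r>0. mball x r \<subseteq> U" using q(1) by blast
  next
    assume "\<exists>r>0. mball x r \<subseteq> U"
    then obtain r where "r > 0" "mball x r \<subseteq> U" by blast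
    then show "\<exists>r>0. \<forall>y\<in>M. ennreal (d x y) < r \<longrightarrow> y \<in> U"
      using that by (intro exI[of _ "ennreal r"]) (auto simp: ennreal_less_iff subset_iff)
  qed
  then show ?thesis
    unfolding topology_eq openin_emtopology openin_mtopology by (meson subset_iff)
qed

definition path_length :: "('a \<Rightarrow> 'a \<Rightarrow> ennreal) \<Rightarrow> real \<Rightarrow> real \<Rightarrow> (real \<Rightarrow> 'a) \<Rightarrow> ennreal" where
  "path_length \<rho> a b \<gamma> =
     Sup {(\<Sum>i<n. \<rho> (\<gamma> (t (Suc i))) (\<gamma> (t i))) | (n :: nat) (t :: nat \<Rightarrow> real).
            t 0 = a \<and> t n = b \<and> (\<forall>i<n. t i \<le> t (Suc i))}"

definition intrinsic :: "'a set \<Rightarrow> ('a \<Rightarrow> 'a \<Rightarrow> ennreal) \<Rightarrow> 'a \<Rightarrow> 'a \<Rightarrow> ennreal" where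
  "intrinsic M \<rho> x y =
     Inf {path_length \<rho> a b \<gamma> | a b \<gamma>.
            a \<le> b \<and> continuous_map (top_of_set {a..b}) (emtopology M \<rho>) \<gamma> \<and> \<gamma> a = x \<and> \<gamma> b = y}"


section \<open>Induced Hausdorff metrics\<close>

definition hausdorff_dist :: "('a \<Rightarrow> 'a \<Rightarrow> ennreal) \<Rightarrow> 'a set \<Rightarrow> 'a set \<Rightarrow> ennreal" where
  "hausdorff_dist \<rho> A B =
     max (Max ((\<lambda>a. Min ((\<lambda>b. \<rho> a b) ` B)) ` A)) (Max ((\<lambda>b. Min ((\<lambda>a. \<rho> a b) ` A)) ` B))"

definition set_stabilizer :: "('a, 'b) monoid_scheme \<Rightarrow> 'a set \<Rightarrow> 'a set" where
  "set_stabilizer G X = {g \<in> carrier G. g <#\<^bsub>G\<^esub> X = X}"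

definition induced_hausdorff ::
  "('a, 'b) monoid_scheme \<Rightarrow> 'a set \<Rightarrow> ('a \<Rightarrow> 'a \<Rightarrow> ennreal) \<Rightarrow> 'a \<Rightarrow> 'a \<Rightarrow> ennreal" where
  "induced_hausdorff G X \<rho> g h = hausdorff_dist \<rho> (g <#\<^bsub>G\<^esub> X) (h <#\<^bsub>G\<^esub> X)"

primrec hausdorff_seq ::
  "('a, 'b) monoid_scheme \<Rightarrow> 'a set \<Rightarrow> ('a \<Rightarrow> 'a \<Rightarrow> real) \<Rightarrow> nat \<Rightarrow> 'a \<Rightarrow> 'a \<Rightarrow> ennreal" where
  "hausdorff_seq G X d 0 = (\<lambda>g h. ennreal (d g h))"
| "hausdorff_seq G X d (Suc i) = intrinsic (carrier G) (induced_hausdorff G X (hausdorff_seq G X d i))"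

end

theory Submission
  imports Defs
begin

text \<open>All steps after the first follow from monotonicity of \<open>\<rho> \<mapsto> \<rho>\<^sub>X\<close> and of
  \<open>\<rho> \<mapsto> intrinsic \<rho>\<close>: a larger extended metric has fewer continuous paths and larger lengths. So
  only \<open>d \<le> d\<^sup>1\<close> needs the group. First, \<open>d\<^sub>X\<close> induces a topology at least as fine as that of \<open>d\<close>:
  if \<open>h X\<close> is close to \<open>g X\<close>, then \<open>h = h e\<close> is close to some \<open>g x\<close>, hence \<open>h X\<close> is
  close to \<open>g x X\<close>, and \<open>x X \<noteq> X\<close> unless \<open>x = e\<close>. Secondly, \<open>d \<le> d\<^sub>X\<close> near each
  point, since the points of \<open>g X\<close> are separated. A path is then cut into pieces on which the local
  inequality applies.\<close>

section \<open>Monotonicity in the metric\<close>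

text \<open>Over finite nonempty sets \<open>Max\<close> and \<open>Min\<close> are attained, so a
  bound on the distance amounts to a choice of partners. With \<open>c\<close> the distance itself,
  every point has a partner within that distance.\<close>

lemma hausdorff_dist_le_iff:
  assumes "finite A" "A \<noteq> {}" "finite B" "B \<noteq> {}"
  shows "hausdorff_dist \<rho> A B \<le> c \<longleftrightarrow>
    (\<forall>a\<in>A. \<exists>b\<in>B. \<rho> a b \<le> c) \<and> (\<forall>b\<in>B. \<exists>a\<in>A. \<rho> a b \<le> c)"
  using assms by (simp add: hausdorff_dist_def Min_le_iff)

lemma hausdorff_dist_mono:
  assumes "finite A" "A \<noteq> {}" "finite B" "B \<noteq> {}"
    and "\<And>a b. a \<in> A \<Longrightarrow> b \<in> B \<Longrightarrow> \<rho> a b \<le> \<sigma> a b"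
  shows "hausdorff_dist \<rho> A B \<le> hausdorff_dist \<sigma> A B"
proof -
  let ?c = "hausdorff_dist \<sigma> A B"
  have le: "\<forall>a\<in>A. \<exists>b\<in>B. \<sigma> a b \<le> ?c" "\<forall>b\<in>B. \<exists>a\<in>A. \<sigma> a b \<le> ?c"
    using hausdorff_dist_le_iff[OF assms(1-4), of \<sigma> ?c] by auto
  show ?thesis
    unfolding hausdorff_dist_le_iff[OF assms(1-4)]
  proof (intro conjI ballI)
    fix a assume a: "a \<in> A"
    then obtain b where "b \<in> B" "\<sigma> a b \<le> ?c" using le(1) by blast
    with assms(5)[OF a] show "\<exists>b\<in>B. \<rho> a b \<le> ?c" by (meson order_trans)
  next
    fix b assume b: "b \<in> B"
    then obtain a where "a \<in> A" "\<sigma> a b \<le> ?c" using le(2) by blast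
    with assms(5)[OF _ b] show "\<exists>a\<in>A. \<rho> a b \<le> ?c" by (meson order_trans)
  qed
qed

lemma path_length_mono:
  assumes "\<And>x y. x \<in> M \<Longrightarrow> y \<in> M \<Longrightarrow> \<rho> x y \<le> \<sigma> x y" and "\<gamma> ` {a..b} \<subseteq> M"
  shows "path_length \<rho> a b \<gamma> \<le> path_length \<sigma> a b \<gamma>"
  unfolding path_length_def
proof (rule Sup_mono, clarify)
  fix n and t :: "nat \<Rightarrow> real"
  assume t: "a = t 0" "b = t n" "\<forall>i<n. t i \<le> t (Suc i)"
  \<comment> \<open>The metrics are compared on \<open>M\<close> only, so the partition points must
    be kept inside \<open>{a..b}\<close>, which the path maps into \<open>M\<close>.\<close>
  have "t i \<le> t j" if "i \<le> j" "j \<le> n" for i j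
    using that
  proof (induction rule: dec_induct)
    case (step k)
    then have "t i \<le> t k" "t k \<le> t (Suc k)"
      using t(3) by auto
    then show ?case by (rule order_trans)
  qed simp
  then have "\<gamma> (t i) \<in> M" if "i \<le> n" for i
    using assms(2) that t by (auto simp: image_subset_iff)
  then have le: "(\<Sum>i<n. \<rho> (\<gamma> (t (Suc i))) (\<gamma> (t i))) \<le> (\<Sum>i<n. \<sigma> (\<gamma> (t (Suc i))) (\<gamma> (t i)))"
    using assms(1) by (intro sum_mono) auto
  show "\<exists>s\<in>{(\<Sum>i<m. \<sigma> (\<gamma> (u (Suc i))) (\<gamma> (u i))) |m u.
      u 0 = t 0 \<and> u m = t n \<and> (\<forall>i<m. u i \<le> u (Suc i))}.
      (\<Sum>i<n. \<rho> (\<gamma> (t (Suc i))) (\<gamma> (t i))) \<le> s"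
  proof (rule bexI)
    show "(\<Sum>i<n. \<rho> (\<gamma> (t (Suc i))) (\<gamma> (t i))) \<le> (\<Sum>i<n. \<sigma> (\<gamma> (t (Suc i))) (\<gamma> (t i)))"
      by (fact le)
  qed (use t(3) in blast)
qed

lemma topspace_emtopology [simp]: "topspace (emtopology M \<rho>) = M"
proof -
  have "openin (emtopology M \<rho>) M"
    unfolding openin_emtopology by (auto intro: exI[of _ 1])
  moreover have "topspace (emtopology M \<rho>) \<subseteq> M"
    using openin_topspace[of "emtopology M \<rho>"] unfolding openin_emtopology by (rule conjunct1)
  ultimately show ?thesis
    by (simp add: openin_subset subset_antisym)
qed

lemma intrinsic_mono:
  assumes "\<And>x y. x \<in> M \<Longrightarrow> y \<in> M \<Longrightarrow> \<rho> x y \<le> \<sigma> x y"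
  shows "intrinsic M \<rho> x y \<le> intrinsic M \<sigma> x y"
  unfolding intrinsic_def
proof (rule Inf_mono, clarify)
  fix a b :: real and \<gamma>
  assume ab: "a \<le> b" and \<gamma>: "continuous_map (top_of_set {a..b}) (emtopology M \<sigma>) \<gamma>"
  \<comment> \<open>The same radius serves for both metrics, since \<open>\<sigma> x y < r\<close>
    forces \<open>\<rho> x y < r\<close>.\<close>
  have "openin (emtopology M \<sigma>) U" if U: "openin (emtopology M \<rho>) U" for U
    unfolding openin_emtopology
  proof (intro conjI ballI)
    show "U \<subseteq> M" using U by (simp add: openin_emtopology)
    fix x assume x: "x \<in> U"
    then obtain r where "r > 0" "\<forall>y\<in>M. \<rho> x y < r \<longrightarrow> y \<in> U"
      using U unfolding openin_emtopology by blast
    moreover have "x \<in> M" using x \<open>U \<subseteq> M\<close> by blast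
    ultimately show "\<exists>r>0. \<forall>y\<in>M. \<sigma> x y < r \<longrightarrow> y \<in> U"
      using le_less_trans[OF assms] by (intro exI[of _ r]) auto
  qed
  then have cont: "continuous_map (top_of_set {a..b}) (emtopology M \<rho>) \<gamma>"
    using \<gamma> by (simp add: continuous_map_def)
  have "\<gamma> ` {a..b} \<subseteq> M"
    using continuous_map_image_subset_topspace[OF \<gamma>] by simp
  then have le: "path_length \<rho> a b \<gamma> \<le> path_length \<sigma> a b \<gamma>"
    by (rule path_length_mono[OF assms, rotated 2])
  show "\<exists>l\<in>{path_length \<rho> a' b' \<gamma>' |a' b' \<gamma>'. a' \<le> b' \<and>
      continuous_map (top_of_set {a'..b'}) (emtopology M \<rho>) \<gamma>' \<and> \<gamma>' a' = \<gamma> a \<and> \<gamma>' b' = \<gamma> b}.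
      l \<le> path_length \<sigma> a b \<gamma>"
  proof (rule bexI)
    show "path_length \<rho> a b \<gamma> \<le> path_length \<sigma> a b \<gamma>" by (fact le)
  qed (use ab cont in blast)
qed

section \<open>Path length under a local bound\<close>

text \<open>As \<open>path_length\<close> is a supremum, one good partition bounds it from below. If
  the mesh is fine enough, consecutive points of the path lie in a common ball from
  \<open>loc\<close>, and the triangle inequality for \<open>d\<close> adds up the local
  bounds.\<close>

lemma (in Metric_space) dist_le_path_length:
  assumes "a \<le> b" and \<gamma>: "continuous_map (top_of_set {a..b}) mtopology \<gamma>"
    and loc: "\<And>x. x \<in> M \<Longrightarrow>
      \<exists>r>0. \<forall>y\<in>mball x r. \<forall>z\<in>mball x r. ennreal (d y z) \<le> \<rho> y z"
  shows "ennreal (d (\<gamma> a) (\<gamma> b)) \<le> path_length \<rho> a b \<gamma>"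
proof -
  have \<gamma>M: "\<gamma> s \<in> M" if "s \<in> {a..b}" for s
    using continuous_map_image_subset_topspace[OF \<gamma>] that by auto
  \<comment> \<open>The cover lives on the parameter line. Its members may stick out of the
    interval, hence the intersections with \<open>{a..b}\<close>.\<close>
  define \<C> where "\<C> = {U. open U \<and>
    (\<forall>s\<in>U \<inter> {a..b}. \<forall>t\<in>U \<inter> {a..b}. ennreal (d (\<gamma> s) (\<gamma> t)) \<le> \<rho> (\<gamma> s) (\<gamma> t))}"
  have "{a..b} \<subseteq> \<Union>\<C>"
  proof
    fix s assume s: "s \<in> {a..b}"
    then obtain r where r: "r > 0"
      "\<And>y z. y \<in> mball (\<gamma> s) r \<Longrightarrow> z \<in> mball (\<gamma> s) r \<Longrightarrow> ennreal (d y z) \<le> \<rho> y z"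
      using loc \<gamma>M by meson
    have "openin (top_of_set {a..b}) {t \<in> {a..b}. \<gamma> t \<in> mball (\<gamma> s) r}"
      using openin_continuous_map_preimage[OF \<gamma> openin_mball] by simp
    then obtain U where "open U" and U: "{t \<in> {a..b}. \<gamma> t \<in> mball (\<gamma> s) r} = {a..b} \<inter> U"
      unfolding openin_open by blast
    have "s \<in> {t \<in> {a..b}. \<gamma> t \<in> mball (\<gamma> s) r}"
      using s r(1) \<gamma>M[OF s] by simp
    then have "s \<in> U"
      unfolding U by blast
    have "\<gamma> t \<in> mball (\<gamma> s) r" if "t \<in> U \<inter> {a..b}" for t
      using that U by blast
    then have "U \<in> \<C>"
      using \<open>open U\<close> r(2) unfolding \<C>_def by blast
    with \<open>s \<in> U\<close> show "s \<in> \<Union>\<C>" by blast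
  qed
  \<comment> \<open>\<open>e\<close> is a Lebesgue number of the cover.\<close>
  then obtain e where "e > 0" and e: "\<And>s. s \<in> {a..b} \<Longrightarrow> \<exists>U\<in>\<C>. ball s e \<subseteq> U"
    by (rule Heine_Borel_lemma[OF compact_Icc]) (auto simp: \<C>_def)
  \<comment> \<open>The strict bound makes the width \<open>w\<close> smaller than \<open>e\<close>,
    so consecutive parameters share a ball of radius \<open>e\<close>. It also forces
    \<open>n > 0\<close> when \<open>a = b\<close>.\<close>
  obtain n :: nat where n: "(b - a) / e < n"
    using reals_Archimedean2 by blast
  then have "n > 0"
    using \<open>a \<le> b\<close> \<open>e > 0\<close> by (metis divide_nonneg_pos diff_ge_0_iff_ge not_gr_zero not_less of_nat_0)
  define w where "w = (b - a) / n"
  have w: "0 \<le> w" "w < e"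
    using n \<open>n > 0\<close> \<open>e > 0\<close> \<open>a \<le> b\<close> by (auto simp: w_def field_simps)
  define t where "t i = a + i * w" for i :: nat
  have t0: "t 0 = a" and tS: "t (Suc i) = t i + w" for i
    by (simp_all add: t_def distrib_right)
  have tn: "t n = b"
    using \<open>n > 0\<close> by (simp add: t_def w_def)
  have tin: "t i \<in> {a..b}" if "i \<le> n" for i
  proof -
    have "i * w \<le> n * w" "0 \<le> i * w"
      using that w(1) by (auto intro: mult_right_mono)
    then show ?thesis
      using tn unfolding t_def by simp
  qed
  have le: "ennreal (d (\<gamma> (t (Suc i))) (\<gamma> (t i))) \<le> \<rho> (\<gamma> (t (Suc i))) (\<gamma> (t i))" if "i < n" for i
  proof -
    have in_ab: "t i \<in> {a..b}" "t (Suc i) \<in> {a..b}"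
      using that tin[of i] tin[of "Suc i"] by auto
    obtain U where "U \<in> \<C>" and U: "ball (t i) e \<subseteq> U"
      using e[OF in_ab(1)] by blast
    have "t i \<in> ball (t i) e" "t (Suc i) \<in> ball (t i) e"
      using w \<open>e > 0\<close> by (auto simp: tS dist_real_def)
    then have "t i \<in> U \<inter> {a..b}" "t (Suc i) \<in> U \<inter> {a..b}"
      using U in_ab by blast+
    with \<open>U \<in> \<C>\<close> show ?thesis
      unfolding \<C>_def by blast
  qed
  have "d (\<gamma> (t m)) (\<gamma> (t 0)) \<le> (\<Sum>i<m. d (\<gamma> (t (Suc i))) (\<gamma> (t i)))" if "m \<le> n" for m
    using that
  proof (induction m)
    case 0
    then show ?case using \<gamma>M[OF tin] by simp
  next
    case (Suc m)
    then have "d (\<gamma> (t (Suc m))) (\<gamma> (t 0)) \<le> d (\<gamma> (t (Suc m))) (\<gamma> (t m)) + d (\<gamma> (t m)) (\<gamma> (t 0))"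
      by (intro triangle \<gamma>M tin) auto
    then show ?case using Suc by simp
  qed
  from this[OF order_refl]
  have "ennreal (d (\<gamma> a) (\<gamma> b)) \<le> ennreal (\<Sum>i<n. d (\<gamma> (t (Suc i))) (\<gamma> (t i)))"
    by (simp only: t0 tn commute[of "\<gamma> b" "\<gamma> a"] ennreal_leI)
  also have "\<dots> = (\<Sum>i<n. ennreal (d (\<gamma> (t (Suc i))) (\<gamma> (t i))))"
    by simp
  also have "\<dots> \<le> (\<Sum>i<n. \<rho> (\<gamma> (t (Suc i))) (\<gamma> (t i)))"
    using le by (intro sum_mono) auto
  also have "\<dots> \<le> path_length \<rho> a b \<gamma>"
    unfolding path_length_def using t0 tn tS w(1)
    by (intro Sup_upper CollectI exI[of _ n] exI[of _ t]) auto
  finally show ?thesis .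
qed

section \<open>Metric groups with continuous right translations\<close>

text \<open>The sets \<open>g X\<close> and \<open>h X\<close> are compared through the pairs
  \<open>g x\<close>, \<open>h x\<close>. Continuity of right translations carries closeness of
  \<open>g\<close> and \<open>h\<close> over to these pairs.\<close>

locale right_continuous_metric_group = group G + Metric_space "carrier G" d
  for G (structure) and d +
  assumes continuous_map_right_mult:
    "x \<in> carrier G \<Longrightarrow> continuous_map mtopology mtopology (\<lambda>g. g \<otimes> x)"
begin

text \<open>Each right translation is continuous at \<open>g\<close>, and finitely many positive
  radii have a positive minimum.\<close>

lemma right_mult_close:
  assumes "finite X" "X \<subseteq> carrier G" "g \<in> carrier G" "\<epsilon> > 0"
  obtains r where "r > 0"
    and "\<And>h x. h \<in> carrier G \<Longrightarrow> d g h < r \<Longrightarrow> x \<in> X \<Longrightarrow> d (g \<otimes> x) (h \<otimes> x) < \<epsilon>"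
proof -
  have "\<exists>r>0. \<forall>h\<in>carrier G. d g h < r \<longrightarrow> (\<forall>x\<in>X. d (g \<otimes> x) (h \<otimes> x) < \<epsilon>)"
    using assms(1,2)
  proof (induction X rule: finite_induct)
    case empty
    then show ?case using zero_less_one by blast
  next
    case (insert x X)
    then obtain r where r: "r > 0" "\<forall>h\<in>carrier G. d g h < r \<longrightarrow> (\<forall>x\<in>X. d (g \<otimes> x) (h \<otimes> x) < \<epsilon>)"
      by auto
    have "openin mtopology {h \<in> topspace mtopology. h \<otimes> x \<in> mball (g \<otimes> x) \<epsilon>}"
      using insert.prems by (intro openin_continuous_map_preimage[OF continuous_map_right_mult]) auto
    moreover have "g \<in> {h \<in> topspace mtopology. h \<otimes> x \<in> mball (g \<otimes> x) \<epsilon>}"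
      using insert.prems assms by auto
    ultimately obtain s where "s > 0" "mball g s \<subseteq> {h \<in> topspace mtopology. h \<otimes> x \<in> mball (g \<otimes> x) \<epsilon>}"
      unfolding openin_mtopology by blast
    then have "s > 0" "\<forall>h\<in>carrier G. d g h < s \<longrightarrow> d (g \<otimes> x) (h \<otimes> x) < \<epsilon>"
      using assms(3) by auto
    then show ?case
      using r by (intro exI[of _ "min r s"]) auto
  qed
  then show thesis using that by blast
qed

text \<open>This is the half of the Hausdorff distance that starts from a point of
  \<open>h X\<close>. It is applied to the point \<open>h\<close> itself, with \<open>x\<close> the
  identity, and to a suitable \<open>h z\<close>.\<close>

lemma induced_hausdorff_attained:
  assumes "finite X" "x \<in> X"
  obtains y where "y \<in> X" "\<rho> (g \<otimes> y) (h \<otimes> x) \<le> induced_hausdorff G X \<rho> g h"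
proof -
  have "finite (k <#\<^bsub>G\<^esub> X)" "k <#\<^bsub>G\<^esub> X \<noteq> {}" for k
    using assms by (auto simp: l_coset_def)
  then have "\<forall>b\<in>h <#\<^bsub>G\<^esub> X. \<exists>a\<in>g <#\<^bsub>G\<^esub> X. \<rho> a b \<le> induced_hausdorff G X \<rho> g h"
    using hausdorff_dist_le_iff unfolding induced_hausdorff_def by blast
  then show thesis
    using assms(2) that by (auto simp: l_coset_def)
qed

text \<open>Since \<open>X\<close> contains the identity, \<open>k\<close> lies in
  \<open>k X\<close> and has a partner \<open>h y\<close> in \<open>h X\<close>. Either the partner
  is \<open>h\<close>, or it lies near a point \<open>g y\<close> other than \<open>g\<close> and is
  farther from \<open>k\<close> than \<open>h\<close> is.\<close>

lemma local_dist_le_induced_hausdorff: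
  assumes X: "finite X" "X \<subseteq> carrier G" "\<one> \<in> X" and g: "g \<in> carrier G"
  shows "\<exists>r>0. \<forall>h\<in>mball g r. \<forall>k\<in>mball g r.
    ennreal (d h k) \<le> induced_hausdorff G X (\<lambda>x y. ennreal (d x y)) h k"
proof -
  obtain c where c: "c > 0" "\<And>y. y \<in> X - {\<one>} \<Longrightarrow> c \<le> d (g \<otimes> y) g"
  proof
    \<comment> \<open>The inserted 1 keeps the minimum defined when \<open>X\<close> contains only
      the identity.\<close>
    show "Min (insert 1 ((\<lambda>y. d (g \<otimes> y) g) ` (X - {\<one>}))) > 0"
      using X g by (auto simp: mdist_pos_less)
  qed (use X in auto)
  obtain r where r: "r > 0"
    "\<And>h x. h \<in> carrier G \<Longrightarrow> d g h < r \<Longrightarrow> x \<in> X \<Longrightarrow> d (g \<otimes> x) (h \<otimes> x) < c / 4"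
    using right_mult_close[OF X(1,2) g, of "c / 4"] c(1) by auto
  have "ennreal (d h k) \<le> induced_hausdorff G X (\<lambda>x y. ennreal (d x y)) h k"
    if h: "h \<in> carrier G" "d g h < r" and k: "k \<in> carrier G" "d g k < r" for h k
  proof -
    obtain y where y: "y \<in> X"
      and le: "ennreal (d (h \<otimes> y) (k \<otimes> \<one>)) \<le> induced_hausdorff G X (\<lambda>x y. ennreal (d x y)) h k"
      using induced_hausdorff_attained[OF X(1,3), of "\<lambda>x y. ennreal (d x y)" h k] by blast
    \<comment> \<open>Taking the identity for \<open>x\<close> in \<open>r(2)\<close> bounds
      \<open>d g h\<close> and \<open>d g k\<close> themselves.\<close>
    have near: "d g h < c / 4" "d g k < c / 4" "d (g \<otimes> y) (h \<otimes> y) < c / 4"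
      using r(2)[OF h X(3)] r(2)[OF k X(3)] r(2)[OF h y] g h k by auto
    have "d h k \<le> d (h \<otimes> y) k"
    proof (cases "y = \<one>")
      \<comment> \<open>The points \<open>g y\<close> and \<open>g\<close> are at least
        \<open>c\<close> apart, while \<open>h y\<close> and \<open>k\<close> are within
        \<open>c / 4\<close> of them. So \<open>h y\<close> and \<open>k\<close> are more than
        \<open>c / 2\<close> apart, but \<open>d h k\<close> is below \<open>c / 2\<close>.\<close>
      case False
      have in_G: "g \<otimes> y \<in> carrier G" "h \<otimes> y \<in> carrier G"
        using X y g h by auto
      have "d h k \<le> d g h + d g k"
        using triangle''[of h g k] triangle[OF h(1) g k(1)] commute[of g h] by linarith
      moreover have "d (g \<otimes> y) g \<le> d (g \<otimes> y) (h \<otimes> y) + d (h \<otimes> y) g"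
        using triangle in_G g by blast
      moreover have "d (h \<otimes> y) g \<le> d (h \<otimes> y) k + d g k"
        using triangle[OF in_G(2) k(1) g] commute[of g k] by simp
      ultimately show ?thesis
        using c(2)[of y] near y False by auto
    qed (use h in simp)
    then show ?thesis
      using le k by (auto intro: order_trans ennreal_leI)
  qed
  then show ?thesis
    using r(1) by (intro exI[of _ r]) auto
qed

text \<open>Some \<open>x z\<close> lies outside \<open>X\<close>, so \<open>g x z\<close> has a
  positive distance to the finite set \<open>g X\<close>. For \<open>h\<close> near
  \<open>g x\<close>, the point \<open>h z\<close> is near \<open>g x z\<close> and therefore stays
  away from \<open>g X\<close>.\<close>

lemma induced_hausdorff_lower_bound_near_translate:
  assumes X: "finite X" "X \<subseteq> carrier G" "set_stabilizer G X = {\<one>}"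
    and g: "g \<in> carrier G" and x: "x \<in> X" "x \<noteq> \<one>"
  shows "\<exists>r>0. \<forall>h\<in>carrier G. d (g \<otimes> x) h < r \<longrightarrow>
    ennreal r \<le> induced_hausdorff G X (\<lambda>x y. ennreal (d x y)) g h"
proof -
  have xG: "x \<in> carrier G" using X x by blast
  have "x <#\<^bsub>G\<^esub> X \<noteq> X"
    using X(3) x xG unfolding set_stabilizer_def by blast
  \<comment> \<open>Equal cardinality strengthens \<open>x X\<close> differing from \<open>X\<close>
    to \<open>x X\<close> not being contained in \<open>X\<close>, which yields
    \<open>z\<close>.\<close>
  moreover have "card (x <#\<^bsub>G\<^esub> X) = card X"
  proof -
    have "inj_on (\<lambda>y. x \<otimes> y) X"
      using inj_on_cmult[OF xG] X(2) by (rule inj_on_subset)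
    moreover have "x <#\<^bsub>G\<^esub> X = (\<lambda>y. x \<otimes> y) ` X"
      by (auto simp: l_coset_def)
    ultimately show ?thesis by (simp add: card_image)
  qed
  ultimately obtain z where z: "z \<in> X" "x \<otimes> z \<notin> X"
    using card_subset_eq[OF X(1), of "x <#\<^bsub>G\<^esub> X"] by (auto simp: l_coset_def)
  have zG: "z \<in> carrier G" using X z by blast
  have ne: "g \<otimes> y \<noteq> g \<otimes> x \<otimes> z" if "y \<in> X" for y
    using that z xG zG g X(2) by (metis Units_eq Units_l_cancel m_assoc m_closed subsetD)
  obtain c where c: "c > 0" "\<And>y. y \<in> X \<Longrightarrow> c \<le> d (g \<otimes> y) (g \<otimes> x \<otimes> z)"
  proof
    show "Min (insert 1 ((\<lambda>y. d (g \<otimes> y) (g \<otimes> x \<otimes> z)) ` X)) > 0"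
      using X g xG zG ne by (auto intro!: mdist_pos_less)
  qed (use X in auto)
  obtain r where r: "r > 0"
    "\<And>h y. h \<in> carrier G \<Longrightarrow> d (g \<otimes> x) h < r \<Longrightarrow> y \<in> X \<Longrightarrow> d (g \<otimes> x \<otimes> y) (h \<otimes> y) < c / 2"
    using right_mult_close[OF X(1,2), of "g \<otimes> x" "c / 2"] c(1) g xG by auto
  show ?thesis
  \<comment> \<open>Half of the gap \<open>c\<close> is lost in moving from \<open>g x z\<close> to
    \<open>h z\<close>. One number serves as radius and as lower bound, so a single choice function
    can record both later.\<close>
  proof (intro exI[of _ "min r (c / 2)"] conjI ballI impI)
    fix h assume h: "h \<in> carrier G" "d (g \<otimes> x) h < min r (c / 2)"
    obtain y where y: "y \<in> X" and
      le: "ennreal (d (g \<otimes> y) (h \<otimes> z)) \<le> induced_hausdorff G X (\<lambda>x y. ennreal (d x y)) g h"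
      using induced_hausdorff_attained[OF X(1) z(1), of "\<lambda>x y. ennreal (d x y)" g h] by blast
    have "d (g \<otimes> x \<otimes> z) (h \<otimes> z) < c / 2"
      using r(2) h z by auto
    moreover have "d (g \<otimes> y) (g \<otimes> x \<otimes> z) \<le> d (g \<otimes> y) (h \<otimes> z) + d (g \<otimes> x \<otimes> z) (h \<otimes> z)"
      using triangle[of "g \<otimes> y" "h \<otimes> z" "g \<otimes> x \<otimes> z"] commute[of "g \<otimes> x \<otimes> z" "h \<otimes> z"]
        X y g xG zG h by auto
    ultimately have "min r (c / 2) \<le> d (g \<otimes> y) (h \<otimes> z)"
      using c(2)[OF y] by auto
    then show "ennreal (min r (c / 2)) \<le> induced_hausdorff G X (\<lambda>x y. ennreal (d x y)) g h"
      using le by (meson ennreal_leI order_trans)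
  qed (use r c in auto)
qed

text \<open>This makes the topology of the induced metric at least as fine as that of
  \<open>d\<close> at \<open>g\<close>. A small induced distance puts \<open>h\<close> near some
  \<open>g y\<close>, and the preceding lemma rules out every \<open>y\<close> except the
  identity.\<close>

lemma dist_less_if_induced_hausdorff_less:
  assumes X: "finite X" "X \<subseteq> carrier G" "\<one> \<in> X" "set_stabilizer G X = {\<one>}"
    and g: "g \<in> carrier G" and "\<epsilon> > 0"
  shows "\<exists>r>0. \<forall>h\<in>carrier G.
    induced_hausdorff G X (\<lambda>x y. ennreal (d x y)) g h < ennreal r \<longrightarrow> d g h < \<epsilon>"
proof -
  obtain R where R: "\<And>x. x \<in> X - {\<one>} \<Longrightarrow> R x > 0"
    "\<And>x h. x \<in> X - {\<one>} \<Longrightarrow> h \<in> carrier G \<Longrightarrow> d (g \<otimes> x) h < R x \<Longrightarrow>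
      ennreal (R x) \<le> induced_hausdorff G X (\<lambda>x y. ennreal (d x y)) g h"
  proof -
    have "\<forall>x\<in>X - {\<one>}. \<exists>r>0. \<forall>h\<in>carrier G. d (g \<otimes> x) h < r \<longrightarrow>
      ennreal r \<le> induced_hausdorff G X (\<lambda>x y. ennreal (d x y)) g h"
    proof
      fix x assume "x \<in> X - {\<one>}"
      then show "\<exists>r>0. \<forall>h\<in>carrier G. d (g \<otimes> x) h < r \<longrightarrow>
        ennreal r \<le> induced_hausdorff G X (\<lambda>x y. ennreal (d x y)) g h"
        using X g by (intro induced_hausdorff_lower_bound_near_translate) auto
    qed
    then obtain R where "\<forall>x\<in>X - {\<one>}. R x > 0 \<and> (\<forall>h\<in>carrier G. d (g \<otimes> x) h < R x \<longrightarrow>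
      ennreal (R x) \<le> induced_hausdorff G X (\<lambda>x y. ennreal (d x y)) g h)"
      by (auto dest: bchoice)
    then show thesis by (intro that[of R]) auto
  qed
  \<comment> \<open>Bounding \<open>r\<close> by every \<open>R x\<close> excludes the wrong
    translates; bounding it by \<open>\<epsilon>\<close> gives the final estimate for
    \<open>y\<close> the identity.\<close>
  define r where "r = Min (insert \<epsilon> (R ` (X - {\<one>})))"
  have r: "r > 0" "r \<le> \<epsilon>" "\<And>x. x \<in> X - {\<one>} \<Longrightarrow> r \<le> R x"
    unfolding r_def using X(1) R(1) \<open>\<epsilon> > 0\<close> by auto
  show ?thesis
  proof (intro exI[of _ r] conjI ballI impI)
    fix h assume h: "h \<in> carrier G"
      and less: "induced_hausdorff G X (\<lambda>x y. ennreal (d x y)) g h < ennreal r"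
    obtain y where y: "y \<in> X" and
      le: "ennreal (d (g \<otimes> y) (h \<otimes> \<one>)) \<le> induced_hausdorff G X (\<lambda>x y. ennreal (d x y)) g h"
      using induced_hausdorff_attained[OF X(1,3), of "\<lambda>x y. ennreal (d x y)" g h] by blast
    have near: "d (g \<otimes> y) h < r"
      using le_less_trans[OF le less] h by (simp add: ennreal_less_iff)
    have "y = \<one>"
    \<comment> \<open>Otherwise \<open>R y\<close> is at most the induced distance, which is below
      \<open>r\<close>, although \<open>r\<close> is at most \<open>R y\<close>.\<close>
    proof (rule ccontr)
      assume "y \<noteq> \<one>"
      then have "ennreal (R y) < ennreal r"
        using R(2)[of y h] y h near r(3)[of y] less by auto
      then show False
        using r(3)[of y] y \<open>y \<noteq> \<one>\<close> by (metis DiffI ennreal_leI not_less singletonD)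
    qed
    then show "d g h < \<epsilon>"
      using near r(2) g by simp
  qed (fact r(1))
qed

lemma dist_le_intrinsic_induced_hausdorff:
  assumes X: "finite X" "X \<subseteq> carrier G" "\<one> \<in> X" "set_stabilizer G X = {\<one>}"
  shows "ennreal (d g h) \<le>
    intrinsic (carrier G) (induced_hausdorff G X (\<lambda>x y. ennreal (d x y))) g h"
  unfolding intrinsic_def
proof (rule Inf_greatest, clarify)
  fix a b :: real and \<gamma>
  let ?\<rho> = "induced_hausdorff G X (\<lambda>x y. ennreal (d x y))"
  assume ab: "a \<le> b" and \<gamma>: "continuous_map (top_of_set {a..b}) (emtopology (carrier G) ?\<rho>) \<gamma>"
  \<comment> \<open>Paths are continuous for the induced metric, whereas
    \<open>dist_le_path_length\<close> needs continuity for \<open>d\<close>; the inclusion of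
    topologies bridges the two.\<close>
  have "openin (emtopology (carrier G) ?\<rho>) U" if U: "openin mtopology U" for U
    unfolding openin_emtopology
  proof (intro conjI ballI)
    fix x assume x: "x \<in> U"
    then obtain \<epsilon> where \<epsilon>: "\<epsilon> > 0" "mball x \<epsilon> \<subseteq> U"
      using U unfolding openin_mtopology by blast
    have xG: "x \<in> carrier G" using U x openin_mtopology by blast
    obtain r where "r > 0" "\<forall>h\<in>carrier G. ?\<rho> x h < ennreal r \<longrightarrow> d x h < \<epsilon>"
      using dist_less_if_induced_hausdorff_less[OF X xG \<epsilon>(1)] by meson
    then show "\<exists>r>0. \<forall>y\<in>carrier G. ?\<rho> x y < r \<longrightarrow> y \<in> U"
      using \<epsilon>(2) xG by (intro exI[of _ "ennreal r"]) auto
  qed (use U openin_mtopology in blast)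
  then have cont: "continuous_map (top_of_set {a..b}) mtopology \<gamma>"
    using \<gamma> by (simp add: continuous_map_def)
  show "ennreal (d (\<gamma> a) (\<gamma> b)) \<le> path_length ?\<rho> a b \<gamma>"
    using local_dist_le_induced_hausdorff[OF X(1-3)]
    by (rule dist_le_path_length[OF ab cont])
qed

end

section \<open>Lie groups and induction along the sequence\<close>

lemma lie_group_right_mult_continuous:
  assumes "lie_group G n T A" "x \<in> carrier G"
  shows "continuous_map T T (\<lambda>g. g \<otimes>\<^bsub>G\<^esub> x)"
proof -
  have "continuous_map (prod_topology T T) T (\<lambda>(x, y). x \<otimes>\<^bsub>G\<^esub> y)" "topspace T = carrier G"
    using assms(1) by (auto simp: lie_group_def smooth_map_def)
  moreover from this have "continuous_map T (prod_topology T T) (\<lambda>g. (g, x))"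
    using assms(2) by (simp add: continuous_map_pairwise o_def)
  ultimately show ?thesis
    using continuous_map_compose[of T "prod_topology T T" "\<lambda>g. (g, x)" T "\<lambda>(x, y). x \<otimes>\<^bsub>G\<^esub> y"]
    by (simp add: o_def)
qed

lemma induced_hausdorff_mono:
  assumes "group G" "finite X" "X \<subseteq> carrier G" "X \<noteq> {}" "g \<in> carrier G" "h \<in> carrier G"
    and "\<And>x y. x \<in> carrier G \<Longrightarrow> y \<in> carrier G \<Longrightarrow> \<rho> x y \<le> \<sigma> x y"
  shows "induced_hausdorff G X \<rho> g h \<le> induced_hausdorff G X \<sigma> g h"
  unfolding induced_hausdorff_def
proof (rule hausdorff_dist_mono)
  interpret group G by fact
  fix a b assume "a \<in> g <#\<^bsub>G\<^esub> X" "b \<in> h <#\<^bsub>G\<^esub> X"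
  then show "\<rho> a b \<le> \<sigma> a b"
    using l_coset_subset_G[OF assms(3,5)] l_coset_subset_G[OF assms(3,6)] by (intro assms(7)) blast+
qed (use assms(2,4) in \<open>auto simp: l_coset_def\<close>)

theorem lemma3p9:
  fixes G :: "('a, 'b) monoid_scheme" and n :: nat and T :: "'a topology" and A :: "'a chart set"
    and d :: "'a \<Rightarrow> 'a \<Rightarrow> real" and X :: "'a set"
  assumes "lie_group G n T A"
    and "Metric_space (carrier G) d"
    and "Metric_space.mtopology (carrier G) d = T"
    and "finite X" and "X \<subseteq> carrier G" and "\<one>\<^bsub>G\<^esub> \<in> X"
    and "set_stabilizer G X = {\<one>\<^bsub>G\<^esub>}"
  shows "(\<forall>g\<in>carrier G. \<forall>h\<in>carrier G. ennreal (d g h) \<le> hausdorff_seq G X d 1 g h) \<and>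
         (\<forall>i. \<forall>g\<in>carrier G. \<forall>h\<in>carrier G.
            hausdorff_seq G X d i g h \<le> hausdorff_seq G X d (Suc i) g h)"
proof -
  have grp: "group G" using assms(1) by (simp add: lie_group_def)
  \<comment> \<open>\<open>assms(3)\<close> turns continuity for the manifold topology into
    continuity for \<open>d\<close>.\<close>
  interpret right_continuous_metric_group G d
    unfolding right_continuous_metric_group_def right_continuous_metric_group_axioms_def
    using grp assms(2) lie_group_right_mult_continuous[OF assms(1)] assms(3) by auto
  have "hausdorff_seq G X d i g h \<le> hausdorff_seq G X d (Suc i) g h"
    if "g \<in> carrier G" "h \<in> carrier G" for i g h
    using that
  \<comment> \<open>The points are generalized because the induction step compares two consecutive
    metrics at all points of the translates of \<open>X\<close>, along whole paths.\<close>
  proof (induction i arbitrary: g h)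
    case 0
    show ?case
      using dist_le_intrinsic_induced_hausdorff[OF assms(4-7)] by simp
  next
    case (Suc i)
    have "X \<noteq> {}" using assms(6) by blast
    then have "induced_hausdorff G X (hausdorff_seq G X d i) x y
        \<le> induced_hausdorff G X (hausdorff_seq G X d (Suc i)) x y"
      if "x \<in> carrier G" "y \<in> carrier G" for x y
      using that by (rule induced_hausdorff_mono[OF grp assms(4,5) _ _ _ Suc.IH])
    then show ?case
      unfolding hausdorff_seq.simps(2) by (rule intrinsic_mono)
  qed
  moreover have "ennreal (d g h) \<le> hausdorff_seq G X d 1 g h" for g h
    using dist_le_intrinsic_induced_hausdorff[OF assms(4-7)] by simp
  ultimately show ?thesis by blast
qed

end
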